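(* Let $X$ and $Y$ be compact subsets of $\mathbb{R}^n$ that are uniformly convex and have $C^{2,\alpha}$ smooth boundaries, where $\alpha\in(0,1)$. Let $c(x,y)=\frac12|x-y|^2$. Let $\mu\in\mathcal{P}(X)$ and $\nu\in\mathcal{P}(Y)$ be probability measures, absolutely continuous with respect to the Lebesgue measure, with densities $p\in C^{0,\alpha}(X)$ and $q\in C^{0,\alpha}(Y)$ respectively, where $p$ and $q$ are bounded away from zero on $X$ and $Y$ respectively. Let $T^\star\colon X\to Y$ be the optimal transport map from $\mu$ to $\nu$ for the cost $c$. Let $t_k\colon X\to Y$ be measurable maps with $t_k\in L^2(\mu)$, and let $\{\psi_k\}\subset C(Y)$ be a family of functions that is uniformly $L$-Lipschitz (every $\psi_k$ is $L$-Lipschitz with the same constant $L$). If $t_k\to T^\star$ in $L^2(\mu)$ as $k\to\infty$, then $$F(\psi_k,t_k)\to W_2(\mu,\nu)^2\qquad\text{and}\qquad d_{KR}(t_{k\sharp}\mu,\nu)\to0\qquad\text{as }k\to\infty.$$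
   Context: $\mathcal{P}(X)$ denotes the Borel probability measures on $X$; $|\cdot|$ is the Euclidean norm; $t_\sharp\mu$ is the push-forward measure $B\mapsto\mu(t^{-1}(B))$. $\|t-T\|_{L^2(\mu)}^2=\int_X|t(x)-T(x)|^2\,d\mu(x)$. For measurable $t\colon X\to Y$ and $\psi\in C(Y)$, $$F(\psi,t)=\int_X c(x,t(x))\,d\mu(x)+\int_Y\psi(y)\,d(\nu-t_\sharp\mu)(y).$$ The optimal transport map $T^\star$ is the ($\mu$-a.e. unique) minimizer of $\int_X c(x,T(x))\,d\mu(x)$ among measurable $T\colon X\to Y$ with $T_\sharp\mu=\nu$. The Kantorovich power metric is normalized with the factor $\frac12$: $$W_2(\mu,\nu)^2=\inf_{\pi\in\Pi(\mu,\nu)}\int_{X\times Y}\tfrac12|x-y|^2\,d\pi(x,y),$$ where $\Pi(\mu,\nu)$ is the set of probability measures on $X\times Y$ with marginals $\mu$ and $\nu$. The Kantorovich--Rubinstein distance between probability measures $\rho,\sigma$ on $Y$ is $$d_{KR}(\rho,\sigma)=\sup\left\{\int_Y\varphi\,d\rho-\int_Y\varphi\,d\sigma:\ \sup_Y|\varphi|\le1,\ |\varphi(x)-\varphi(y)|\le|x-y|\ \ \forall x,y\in Y\right\}.$$ *)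

theory Defs
  imports "HOL-Probability.Probability"
begin

section \<open>Regularity of functions and of domains\<close>

definition hoelder_on :: "real \<Rightarrow> 'a::metric_space set \<Rightarrow> ('a \<Rightarrow> 'b::metric_space) \<Rightarrow> bool" where
  "hoelder_on \<alpha> S f \<longleftrightarrow> (\<exists>C\<ge>0. \<forall>x\<in>S. \<forall>y\<in>S. dist (f x) (f y) \<le> C * dist x y powr \<alpha>)"

text \<open>Here \<open>g\<close> is the gradient and \<open>H\<close> the Hessian of the \<open>C\<^sup>2\<close> function \<open>\<phi>\<close>.\<close>

definition C2_defining_function ::
  "(real^'n) set \<Rightarrow> (real^'n) set \<Rightarrow> (real^'n \<Rightarrow> real) \<Rightarrow> (real^'n \<Rightarrow> real^'n) \<Rightarrow> (real^'n \<Rightarrow> real^'n^'n) \<Rightarrow> bool"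
where
  "C2_defining_function X U \<phi> g H \<longleftrightarrow>
     (\<forall>x\<in>U. (\<phi> has_derivative (\<lambda>v. g x \<bullet> v)) (at x)) \<and>
     (\<forall>x\<in>U. (g has_derivative (\<lambda>v. H x *v v)) (at x)) \<and>
     continuous_on U H \<and>
     (\<forall>x\<in>U. g x \<noteq> 0) \<and>
     X \<inter> U = {x \<in> U. \<phi> x \<le> 0}"

definition C2_hoelder_boundary :: "real \<Rightarrow> (real^'n) set \<Rightarrow> bool" where
  "C2_hoelder_boundary \<alpha> X \<longleftrightarrow>
     (\<forall>z\<in>frontier X. \<exists>r>0. \<exists>\<phi> g H.
        C2_defining_function X (ball z r) \<phi> g H \<and> hoelder_on \<alpha> (ball z r) H)"

text \<open>
  Uniform convexity of a domain with \<open>C\<^sup>2\<close> boundary: the principal curvatures of the boundary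
  are bounded below by a positive constant. On the tangent space \<open>{v. v \<bullet> g z = 0}\<close> the second
  fundamental form with respect to the inner normal is \<open>(v \<bullet> (H z *v v)) / norm (g z)\<close>; it does
  not depend on the choice of the defining function.
\<close>

definition uniformly_convex :: "(real^'n) set \<Rightarrow> bool" where
  "uniformly_convex X \<longleftrightarrow> convex X \<and>
     (\<exists>\<kappa>>0. \<forall>z\<in>frontier X. \<exists>r>0. \<exists>\<phi> g H.
        C2_defining_function X (ball z r) \<phi> g H \<and>
        (\<forall>v. v \<bullet> g z = 0 \<longrightarrow> (v \<bullet> (H z *v v)) / norm (g z) \<ge> \<kappa> * (norm v)\<^sup>2))"

section \<open>Optimal transport\<close>

text \<open>
  These notions are meant for probability measures on compact sets. The integrands are then bounded
  and measurable, so that the real-valued Bochner integrals, infima and suprema below are never default values.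
\<close>

abbreviation borel_on :: "'a::topological_space set \<Rightarrow> 'a measure" where
  "borel_on X \<equiv> restrict_space borel X"

definition borel_prob_measures :: "'a::topological_space set \<Rightarrow> 'a measure set" where
  "borel_prob_measures X = {M. prob_space M \<and> sets M = sets (borel_on X)}"

definition has_density_on ::
  "'a::euclidean_space measure \<Rightarrow> 'a set \<Rightarrow> ('a \<Rightarrow> real) \<Rightarrow> bool" where
  "has_density_on M X f \<longleftrightarrow> M = density (restrict_space lborel X) (\<lambda>x. ennreal (f x))"

definition quadratic_cost :: "'a::real_normed_vector \<Rightarrow> 'a \<Rightarrow> real" where
  "quadratic_cost x y = 1/2 * (norm (x - y))\<^sup>2"

definition L2_maps :: "'a measure \<Rightarrow> ('a \<Rightarrow> 'b::euclidean_space) set" where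
  "L2_maps M = {t \<in> borel_measurable M. integrable M (\<lambda>x. (norm (t x))\<^sup>2)}"

definition L2_distance :: "'a measure \<Rightarrow> ('a \<Rightarrow> 'b::euclidean_space) \<Rightarrow> ('a \<Rightarrow> 'b) \<Rightarrow> real" where
  "L2_distance M t T = sqrt (\<integral>x. (norm (t x - T x))\<^sup>2 \<partial>M)"

definition push_forward ::
  "'b::topological_space set \<Rightarrow> ('a \<Rightarrow> 'b) \<Rightarrow> 'a measure \<Rightarrow> 'b measure" where
  "push_forward Y t M = distr M (borel_on Y) t"

definition transport_cost :: "('a \<Rightarrow> 'b \<Rightarrow> real) \<Rightarrow> 'a measure \<Rightarrow> ('a \<Rightarrow> 'b) \<Rightarrow> real" where
  "transport_cost c \<mu> t = (\<integral>x. c x (t x) \<partial>\<mu>)"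

definition transport_maps ::
  "'a::topological_space set \<Rightarrow> 'b::topological_space set \<Rightarrow> 'a measure \<Rightarrow> 'b measure \<Rightarrow> ('a \<Rightarrow> 'b) set"
where
  "transport_maps X Y \<mu> \<nu> = {T \<in> borel_on X \<rightarrow>\<^sub>M borel_on Y. push_forward Y T \<mu> = \<nu>}"

definition optimal_transport_map ::
  "'a::topological_space set \<Rightarrow> 'b::topological_space set \<Rightarrow> ('a \<Rightarrow> 'b \<Rightarrow> real) \<Rightarrow>
   'a measure \<Rightarrow> 'b measure \<Rightarrow> ('a \<Rightarrow> 'b) \<Rightarrow> bool"
where
  "optimal_transport_map X Y c \<mu> \<nu> T \<longleftrightarrow>
     T \<in> transport_maps X Y \<mu> \<nu> \<and>
     (\<forall>S\<in>transport_maps X Y \<mu> \<nu>. transport_cost c \<mu> T \<le> transport_cost c \<mu> S)"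

text \<open>The integral of \<open>\<psi>\<close> against the signed measure \<open>\<nu> - t\<^sub>\<sharp>\<mu>\<close> is the difference of the two integrals.\<close>

definition saddle_functional ::
  "'b::topological_space set \<Rightarrow> ('a \<Rightarrow> 'b \<Rightarrow> real) \<Rightarrow> 'a measure \<Rightarrow> 'b measure \<Rightarrow>
   ('b \<Rightarrow> real) \<Rightarrow> ('a \<Rightarrow> 'b) \<Rightarrow> real"
where
  "saddle_functional Y c \<mu> \<nu> \<psi> t =
     transport_cost c \<mu> t + ((\<integral>y. \<psi> y \<partial>\<nu>) - (\<integral>y. \<psi> y \<partial>(push_forward Y t \<mu>)))"

definition couplings :: "'a measure \<Rightarrow> 'b measure \<Rightarrow> ('a \<times> 'b) measure set" where
  "couplings \<mu> \<nu> = {\<pi>. prob_space \<pi> \<and> sets \<pi> = sets (\<mu> \<Otimes>\<^sub>M \<nu>) \<and>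
                      distr \<pi> \<mu> fst = \<mu> \<and> distr \<pi> \<nu> snd = \<nu>}"

definition W2 :: "'a::real_normed_vector measure \<Rightarrow> 'a measure \<Rightarrow> real" where
  "W2 \<mu> \<nu> = sqrt (INF \<pi>\<in>couplings \<mu> \<nu>. \<integral>z. quadratic_cost (fst z) (snd z) \<partial>\<pi>)"

definition d_KR :: "'a::metric_space set \<Rightarrow> 'a measure \<Rightarrow> 'a measure \<Rightarrow> real" where
  "d_KR Y \<rho> \<sigma> =
     (SUP \<phi>\<in>{\<phi>. (\<forall>y\<in>Y. \<bar>\<phi> y\<bar> \<le> 1) \<and> (\<forall>x\<in>Y. \<forall>y\<in>Y. \<bar>\<phi> x - \<phi> y\<bar> \<le> dist x y)}.
        (\<integral>y. \<phi> y \<partial>\<rho>) - (\<integral>y. \<phi> y \<partial>\<sigma>))"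

end

theory Submission
  imports Defs
begin

text \<open>
  Everything is controlled by \<open>\<delta> k\<close>, the integral of \<open>norm (t k x - T x)\<close> against \<open>\<mu>\<close>, which tends
  to 0 because on a probability space it is at most the \<open>L\<^sup>2\<close> distance
  (\<open>integral_norm_le_L2_distance\<close>). On bounded sets the quadratic cost is Lipschitz in its second argument,
  so the transport costs of \<open>t k\<close> and \<open>T\<close> differ by at most a multiple of \<open>\<delta> k\<close>
  (\<open>transport_cost_quadratic_diff_le\<close>). As \<open>T\<close> pushes \<open>\<mu>\<close> to \<open>\<nu>\<close>, the integrals of an
  \<open>L\<close>-Lipschitz function against \<open>\<nu>\<close> and against the push-forward under \<open>t k\<close> differ by at most
  \<open>L * \<delta> k\<close> (\<open>lipschitz_integral_push_forward_le\<close>). With \<open>L = 1\<close> and a supremum over the test functions this is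
  the Kantorovich-Rubinstein statement, and the two estimates together show that the saddle functional tends
  to the transport cost of \<open>T\<close>.

  It remains to identify this limit with the squared Kantorovich metric. By hypothesis \<open>T\<close> is optimal only
  among maps, whereas the metric is an infimum over couplings, so the equality of the values of the Monge and
  Kantorovich problems is needed (\<open>monge_eq_kantorovich\<close>). It is obtained without duality and without convex
  potentials: since \<open>\<mu>\<close> has no mass on hyperplanes, every coupling can be approximated by transport maps that
  have exactly the prescribed marginals. To this end \<open>X\<close> is cut into small cells, and the restriction of \<open>\<mu>\<close> to
  each cell is transported onto the part of the coupling lying over that cell
  (\<open>transport_along_factor\<close>). Such a transport exists between any atomless source and any target
  (\<open>transport_from_atomless\<close>): the source is mapped to the line by a linear functional, rearranged
  monotonically there, and decoded into the target space by a Borel left inverse of a Borel coding by real numbers.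
\<close>

section \<open>Borel coding by real numbers\<close>

text \<open>
  A bit sequence is read as a ternary expansion with digits 0 and 1. In base 2 the two expansions of
  a dyadic rational would clash; in base 3 the tail after any position contributes at most half a
  unit of that position, so every bit is recovered by rounding down.
\<close>

definition ternary_code :: "(nat \<Rightarrow> bool) \<Rightarrow> real" where
  "ternary_code a = (\<Sum>k. of_bool (a k) / 3 ^ k)"

definition ternary_bit :: "nat \<Rightarrow> real \<Rightarrow> bool" where
  "ternary_bit k r \<longleftrightarrow> \<lfloor>3 ^ k * r\<rfloor> mod 3 = 1"

lemma summable_ternary_code: "summable (\<lambda>k. of_bool (a k) / 3 ^ k :: real)"
  by (rule summable_comparison_test'[of "\<lambda>k. (1/3) ^ k" 0, OF summable_geometric])
     (auto simp: power_divide divide_right_mono)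

lemma ternary_code_bounds: "0 \<le> ternary_code a" "ternary_code a \<le> 3/2"
proof -
  show "0 \<le> ternary_code a"
    unfolding ternary_code_def by (intro suminf_nonneg summable_ternary_code) auto
  have "ternary_code a \<le> (\<Sum>k. (1/3) ^ k)"
    unfolding ternary_code_def
    by (intro suminf_le summable_ternary_code summable_geometric)
       (auto simp: power_divide divide_right_mono)
  also have "\<dots> = 3/2" by (subst suminf_geometric) auto
  finally show "ternary_code a \<le> 3/2" .
qed

lemma ternary_code_rec:
  "ternary_code a = of_bool (a 0) + ternary_code (\<lambda>k. a (Suc k)) / 3"
proof -
  have "ternary_code a = of_bool (a 0) + (\<Sum>k. of_bool (a (Suc k)) / 3 ^ Suc k)"
    unfolding ternary_code_def using suminf_split_head[OF summable_ternary_code[of a]] by simp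
  also have "(\<Sum>k. of_bool (a (Suc k)) / 3 ^ Suc k) = (\<Sum>k. (of_bool (a (Suc k)) / 3 ^ k) / 3 :: real)"
    by (simp add: field_simps)
  also have "\<dots> = ternary_code (\<lambda>k. a (Suc k)) / 3"
    unfolding ternary_code_def
    by (intro suminf_divide summable_ternary_code[of "\<lambda>k. a (Suc k)"])
  finally show ?thesis .
qed

lemma ternary_bit_code: "ternary_bit k (ternary_code a) \<longleftrightarrow> a k"
proof (induction k arbitrary: a)
  case 0
  have "\<lfloor>ternary_code a\<rfloor> = of_bool (a 0)"
    using ternary_code_bounds[of "\<lambda>k. a (Suc k)"]
    by (subst ternary_code_rec) (auto simp: floor_eq_iff)
  then show ?case by (simp add: ternary_bit_def)
next
  case (Suc k)
  define b where "b = (\<lambda>k. a (Suc k))"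
  have "3 ^ Suc k * ternary_code a
      = 3 ^ k * ternary_code b + of_int (3 * (3 ^ k * of_bool (a 0)))"
    by (subst ternary_code_rec) (simp add: algebra_simps b_def)
  then have "\<lfloor>3 ^ Suc k * ternary_code a\<rfloor> = \<lfloor>3 ^ k * ternary_code b\<rfloor> + 3 * (3 ^ k * of_bool (a 0))"
    by (simp only: floor_add_int)
  then have "ternary_bit (Suc k) (ternary_code a) = ternary_bit k (ternary_code b)"
    unfolding ternary_bit_def by (metis mod_mult_self2)
  then show ?case by (simp add: Suc b_def)
qed

lemma measurable_ternary_bit [measurable]: "Measurable.pred borel (ternary_bit k)"
  unfolding ternary_bit_def by measurable

text \<open>
  This is the one consequence of the Borel isomorphism theorem that is needed. A point is coded by the bits
  telling, for each scale \<open>m\<close> and each element \<open>e j\<close> of a dense sequence, whether \<open>e j\<close> lies within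
  \<open>1 / Suc m\<close> of it. Decoding takes the first such \<open>e j\<close> at each scale and passes to the limit, and
  is measurable as a pointwise limit of measurable functions.
\<close>

lemma borel_coding_real:
  fixes A :: "'a::{banach, second_countable_topology} set"
  assumes A: "A \<in> sets borel" "A \<noteq> {}"
  obtains h :: "'a \<Rightarrow> real" and d :: "real \<Rightarrow> 'a"
  where "h \<in> borel_on A \<rightarrow>\<^sub>M borel" "d \<in> borel \<rightarrow>\<^sub>M borel_on A" "\<And>y. y \<in> A \<Longrightarrow> d (h y) = y"
proof -
  obtain D :: "'a set" where D: "countable D" "\<And>S. open S \<Longrightarrow> S \<noteq> {} \<Longrightarrow> \<exists>d\<in>D. d \<in> S"
    using countable_dense_setE by blast
  have "D \<noteq> {}" using D(2)[of UNIV] by auto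
  define e where "e = from_nat_into D"
  have e: "\<exists>j. dist (y::'a) (e j) < \<delta>" if "\<delta> > 0" for y \<delta>
  proof -
    have "ball y \<delta> \<noteq> {}" using that by simp
    then obtain x where "x \<in> D" "x \<in> ball y \<delta>" using D(2)[OF open_ball] by blast
    moreover from this obtain j where "e j = x"
      using from_nat_into_surj[OF D(1)] unfolding e_def by blast
    ultimately show ?thesis by auto
  qed
  define b where "b y n = (case prod_decode n of (m, j) \<Rightarrow> dist y (e j) < 1 / Suc m)" for y n
  define h where "h y = ternary_code (b y)" for y
  define d0 where "d0 r = lim (\<lambda>m. e (LEAST j. ternary_bit (prod_encode (m, j)) r))" for r
  obtain y0 where y0: "y0 \<in> A" using A by auto
  define d where "d r = (if d0 r \<in> A then d0 r else y0)" for r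
  have bm [measurable]: "Measurable.pred borel (\<lambda>y. b y n)" for n
    unfolding b_def by (cases "prod_decode n") simp
  have h [measurable]: "h \<in> borel_measurable borel"
    unfolding h_def ternary_code_def by measurable
  have em [measurable]: "e \<in> count_space UNIV \<rightarrow>\<^sub>M borel" by simp
  have d0 [measurable]: "d0 \<in> borel_measurable borel"
    unfolding d0_def by measurable
  have d: "d \<in> borel \<rightarrow>\<^sub>M borel_on A"
  proof (rule measurable_restrict_space2)
    show "d \<in> space borel \<rightarrow> A" using y0 by (auto simp: d_def)
    show "d \<in> borel \<rightarrow>\<^sub>M borel" unfolding d_def using A(1) by measurable
  qed
  have "d0 (h y) = y" for y
  proof -
    define s where "s m = (LEAST j. dist y (e j) < 1 / Suc m)" for m
    have s: "dist y (e (s m)) < 1 / Suc m" for m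
      unfolding s_def by (rule LeastI_ex, rule e) simp
    have "(\<lambda>m. e (s m)) \<longlonglongrightarrow> y"
    proof (rule metric_tendsto_imp_tendsto)
      show "(\<lambda>m. 1 / real (Suc m)) \<longlonglongrightarrow> 0" by (rule LIMSEQ_Suc[OF lim_1_over_n])
      show "\<forall>\<^sub>F m in sequentially. dist (e (s m)) y \<le> dist (1 / real (Suc m)) 0"
        using less_imp_le[OF s] by (intro always_eventually) (simp add: dist_commute)
    qed
    moreover have "d0 (h y) = lim (\<lambda>m. e (s m))"
      unfolding d0_def h_def ternary_bit_code b_def s_def by simp
    ultimately show ?thesis by (simp add: limI)
  qed
  then have "d (h y) = y" if "y \<in> A" for y using that by (simp add: d_def)
  moreover have "h \<in> borel_on A \<rightarrow>\<^sub>M borel" by (intro measurable_restrict_space1 h)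
  ultimately show ?thesis using that d by blast
qed

section \<open>Transporting an atomless measure\<close>

text \<open>
  The monotone rearrangement. The quantile function \<open>I\<close> of any distribution pushes the uniform
  measure on the unit interval to it. Without atoms the distribution function \<open>C\<close> is continuous,
  hence \<open>C (I u) = u\<close>, and therefore \<open>C\<close> pushes \<open>M\<close> back to the uniform measure.
\<close>

lemma transport_between_real:
  assumes M: "real_distribution M" and N: "real_distribution N"
    and atomless: "\<And>c. measure M {c} = 0"
  shows "\<exists>S\<in>borel_measurable borel. distr M borel S = N"
proof -
  interpret M: cdf_distribution M using M by (simp add: cdf_distribution_def)
  interpret N: cdf_distribution N using N by (simp add: cdf_distribution_def)
  let ?U = "restrict_space lborel {0<..<1::real}"
  \<comment> \<open>The default 0 outside the open unit interval only makes the quantile function globally Borel.\<close>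
  define Q where "Q u = indicator {0<..<1} u *\<^sub>R N.I u" for u
  have Q [measurable]: "Q \<in> borel_measurable borel"
    unfolding Q_def using N.measurable_CI
    by (subst (asm) borel_measurable_restrict_space_iff) auto
  have MI: "M.I \<in> ?U \<rightarrow>\<^sub>M borel"
    using M.measurable_CI
    by (simp add: measurable_def space_restrict_space sets_restrict_space)
  have id: "M.C (M.I u) = u" if u: "u \<in> {0<..<1}" for u
  proof (rule antisym)
    show "u \<le> M.C (M.I u)" using M.pseudoinverse'[rule_format, OF u] by blast
    have "isCont M.C (M.I u)" using atomless M.isCont_cdf by blast
    then have "(M.C \<longlongrightarrow> M.C (M.I u)) (at_left (M.I u))"
      unfolding isCont_def by (rule tendsto_within_subset) auto
    moreover have "\<forall>\<^sub>F x in at_left (M.I u). M.C x \<le> u"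
      unfolding eventually_at_filter
    proof (intro always_eventually allI impI)
      fix x assume "x \<in> {..<M.I u}"
      then have "\<not> u \<le> M.C x" using M.pseudoinverse'[rule_format, OF u, of x] by simp
      then show "M.C x \<le> u" by simp
    qed
    ultimately show "M.C (M.I u) \<le> u"
      by (rule tendsto_upperbound) simp
  qed
  have "distr M borel (\<lambda>x. Q (M.C x)) = distr (distr ?U borel M.I) borel (\<lambda>x. Q (M.C x))"
    by (simp add: M.distr_I_eq_M)
  also have "\<dots> = distr ?U borel (\<lambda>u. Q (M.C (M.I u)))"
    using MI by (subst distr_distr) (auto simp: comp_def)
  also have "\<dots> = distr ?U borel N.I"
    by (intro distr_cong) (auto simp: space_restrict_space id Q_def)
  also have "\<dots> = N" by (rule N.distr_I_eq_M)
  finally show ?thesis by (intro bexI[of _ "\<lambda>x. Q (M.C x)"]) auto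
qed

text \<open>
  The source is reduced to the line by the function \<open>f\<close> whose law has no atoms, the target by the
  Borel coding; in between acts the monotone rearrangement.
\<close>

lemma transport_from_atomless:
  fixes A :: "'b::{banach, second_countable_topology} set" and f :: "'a \<Rightarrow> real"
  assumes M: "prob_space M" and f [measurable]: "f \<in> borel_measurable M"
    and atomless: "\<And>c. AE x in M. f x \<noteq> c"
    and N: "prob_space N" and setsN: "sets N = sets (borel_on A)" and A: "A \<in> sets borel"
  shows "\<exists>S\<in>M \<rightarrow>\<^sub>M N. distr M N S = N"
proof -
  interpret M: prob_space M by fact
  interpret N: prob_space N by fact
  have "A \<noteq> {}" using N.not_empty sets_eq_imp_space_eq[OF setsN] by (simp add: space_restrict_space)
  then obtain h :: "'b \<Rightarrow> real" and d where h': "h \<in> borel_on A \<rightarrow>\<^sub>M borel"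
    and d': "d \<in> borel \<rightarrow>\<^sub>M borel_on A" and dh: "\<And>y. y \<in> A \<Longrightarrow> d (h y) = y"
    using borel_coding_real[OF A] by blast
  have h [measurable]: "h \<in> N \<rightarrow>\<^sub>M borel" using h' setsN by (simp cong: measurable_cong_sets)
  have d [measurable]: "d \<in> borel \<rightarrow>\<^sub>M N" using d' setsN by (simp cong: measurable_cong_sets)
  have spN: "space N = A" using sets_eq_imp_space_eq[OF setsN] by (simp add: space_restrict_space)
  have "real_distribution (distr M borel f)" "real_distribution (distr N borel h)"
    by (auto intro!: real_distribution.intro M.prob_space_distr N.prob_space_distr simp: real_distribution_axioms_def)
  moreover have "measure (distr M borel f) {c} = 0" for c
  proof -
    have "measure (distr M borel f) {c} = measure M (f -` {c} \<inter> space M)"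
      by (simp add: measure_distr)
    also have "\<dots> = 0"
      using atomless[of c] by (subst M.prob_eq_0) auto
    finally show ?thesis .
  qed
  ultimately obtain S where S [measurable]: "S \<in> borel_measurable borel"
    and SN: "distr (distr M borel f) borel S = distr N borel h"
    using transport_between_real by blast
  have "distr M N (\<lambda>x. d (S (f x))) = distr (distr (distr M borel f) borel S) N d"
    by (simp add: distr_distr comp_def)
  also have "\<dots> = distr N N (\<lambda>y. d (h y))"
    by (simp add: SN distr_distr comp_def)
  also have "\<dots> = distr N N (\<lambda>y. y)"
    by (intro distr_cong) (auto simp: dh spN)
  also have "\<dots> = N" by (rule distr_id)
  finally show ?thesis by (intro bexI[of _ "\<lambda>x. d (S (f x))"]) auto
qed

section \<open>Monge and Kantorovich problems have the same value\<close>

text \<open>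
  Read \<open>N\<close> as a coupling and \<open>g\<close> as the projection to its first marginal \<open>M\<close>. Cut \<open>X\<close> into finitely many
  cells of small diameter and, cell by cell, transport the conditional measure of \<open>M\<close> on the cell to the
  conditional measure of \<open>N\<close> over it. The glued map \<open>G\<close> pushes \<open>M\<close> to \<open>N\<close> exactly, and
  \<open>g (G x)\<close> stays in the cell of \<open>x\<close>.
\<close>

lemma transport_along_factor:
  fixes X :: "'a::{metric_space, second_countable_topology} set"
    and A :: "'b::{banach, second_countable_topology} set"
  assumes M: "prob_space M" "sets M = sets (borel_on X)" and X: "compact X"
    and f: "f \<in> borel_measurable M" and atomless: "\<And>c::real. AE x in M. f x \<noteq> c"
    and N: "prob_space N" "sets N = sets (borel_on A)" "A \<in> sets borel"
    and g [measurable]: "g \<in> N \<rightarrow>\<^sub>M M" and gN: "distr N M g = M" and \<epsilon>: "\<epsilon> > 0"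
  shows "\<exists>G\<in>M \<rightarrow>\<^sub>M N. distr M N G = N \<and> (AE x in M. dist (g (G x)) x < \<epsilon>)"
proof -
  interpret M: prob_space M by fact
  interpret N: prob_space N by fact
  have spM: "space M = X" using sets_eq_imp_space_eq[OF M(2)] by (simp add: space_restrict_space)
  have "X \<subseteq> (\<Union>x\<in>X. ball x (\<epsilon>/2))" using \<epsilon> by auto
  then obtain C where C: "finite C" "X \<subseteq> (\<Union>x\<in>C. ball x (\<epsilon>/2))"
    by (rule compactE_image[OF X open_ball])
  obtain c :: "nat \<Rightarrow> 'a" and m where c: "C = c ` {i. i < m}"
    using finite_imp_nat_seg_image_inj_on[OF C(1)] by metis
  \<comment> \<open>The cells are the balls of a finite cover, made disjoint by taking the first ball containing a point.\<close>
  define idx where "idx x = (LEAST i. dist (c i) x < \<epsilon>/2)" for x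
  have idx: "dist (c (idx x)) x < \<epsilon>/2" if "x \<in> X" for x
  proof -
    have "\<exists>i. dist (c i) x < \<epsilon>/2" using subsetD[OF C(2) that] by (auto simp: c)
    then show ?thesis unfolding idx_def by (rule LeastI_ex)
  qed
  have idm [measurable]: "(\<lambda>x. x) \<in> M \<rightarrow>\<^sub>M borel"
    unfolding measurable_cong_sets[OF M(2) refl] by (intro measurable_restrict_space1) simp
  have [measurable]: "idx \<in> M \<rightarrow>\<^sub>M count_space UNIV"
    unfolding idx_def by measurable
  define cell where "cell i = {x \<in> space M. idx x = i}" for i
  have cell [measurable]: "cell i \<in> sets M" for i unfolding cell_def by measurable
  define D where "D i = g -` cell i \<inter> space N" for i
  have D [measurable]: "D i \<in> sets N" for i unfolding D_def by measurable
  have emD: "emeasure N (D i) = emeasure M (cell i)" for i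
    unfolding D_def by (subst gN[symmetric]) (simp add: emeasure_distr)
  have "\<exists>S\<in>M \<rightarrow>\<^sub>M N. emeasure M (cell i) \<noteq> 0 \<longrightarrow>
          distr (uniform_measure M (cell i)) N S = uniform_measure N (D i)" for i
  proof (cases "emeasure M (cell i) = 0")
    case True
    obtain z where "z \<in> space N" using N.not_empty by blast
    then show ?thesis using True by (intro bexI[of _ "\<lambda>_. z"]) auto
  next
    case False
    have "\<exists>S\<in>uniform_measure M (cell i) \<rightarrow>\<^sub>M uniform_measure N (D i).
        distr (uniform_measure M (cell i)) (uniform_measure N (D i)) S = uniform_measure N (D i)"
    proof (rule transport_from_atomless)
      show "prob_space (uniform_measure M (cell i))" "prob_space (uniform_measure N (D i))"
        using False emD by (auto intro!: prob_space_uniform_measure)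
      show "f \<in> borel_measurable (uniform_measure M (cell i))"
        using f by (simp cong: measurable_cong_sets)
      show "AE x in uniform_measure M (cell i). f x \<noteq> c" for c
        using atomless[of c] by (intro AE_uniform_measureI) auto
      show "sets (uniform_measure N (D i)) = sets (borel_on A)" by (simp add: N)
    qed (rule N)
    moreover have "distr (uniform_measure M (cell i)) (uniform_measure N (D i)) S
        = distr (uniform_measure M (cell i)) N S" for S
      by (intro distr_cong) auto
    ultimately show ?thesis by (auto cong: measurable_cong_sets)
  qed
  then obtain S where S [measurable]: "\<And>i. S i \<in> M \<rightarrow>\<^sub>M N"
    and SN: "\<And>i. emeasure M (cell i) \<noteq> 0 \<Longrightarrow>
          distr (uniform_measure M (cell i)) N (S i) = uniform_measure N (D i)"
    by metis
  define G where "G x = S (idx x) x" for x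
  have G [measurable]: "G \<in> M \<rightarrow>\<^sub>M N"
    unfolding G_def by (rule measurable_compose_countable) measurable
  \<comment> \<open>Both sides vanish over null cells, where nothing is known about the map chosen there.\<close>
  have piece: "emeasure M (cell i \<inter> (S i -` B \<inter> space M)) = emeasure N (D i \<inter> B)"
    if B [measurable]: "B \<in> sets N" for i B
  proof (cases "emeasure M (cell i) = 0")
    case True
    then have "emeasure N (D i) = 0" by (simp add: emD)
    then show ?thesis using True
      by (metis D cell emeasure_mono inf_le1 le_zero_eq)
  next
    case False
    have "emeasure (uniform_measure N (D i)) B
        = emeasure (distr (uniform_measure M (cell i)) N (S i)) B"
      by (simp add: SN[OF False])
    also have "\<dots> = emeasure (uniform_measure M (cell i)) (S i -` B \<inter> space M)"
      by (subst emeasure_distr) (auto cong: measurable_cong_sets)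
    finally have "emeasure N (D i \<inter> B) / emeasure M (cell i)
        = emeasure M (cell i \<inter> (S i -` B \<inter> space M)) / emeasure M (cell i)"
      by (simp add: emD)
    then have "emeasure N (D i \<inter> B) / emeasure M (cell i) * emeasure M (cell i)
        = emeasure M (cell i \<inter> (S i -` B \<inter> space M)) / emeasure M (cell i) * emeasure M (cell i)"
      by simp
    moreover have "emeasure M (cell i) < top"
      by (simp add: M.emeasure_eq_measure)
    ultimately show ?thesis using False by (simp add: ennreal_divide_times ennreal_divide_self)
  qed
  have "distr M N G = N"
  proof (rule measure_eqI)
    fix B assume "B \<in> sets (distr M N G)"
    then have B [measurable]: "B \<in> sets N" by simp
    have "emeasure (distr M N G) B = emeasure M (G -` B \<inter> space M)"
      by (simp add: emeasure_distr)
    also have "G -` B \<inter> space M = (\<Union>i. cell i \<inter> (S i -` B \<inter> space M))"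
      by (auto simp: G_def cell_def)
    also have "emeasure M \<dots> = (\<Sum>i. emeasure M (cell i \<inter> (S i -` B \<inter> space M)))"
      by (rule suminf_emeasure[symmetric]) (auto simp: disjoint_family_on_def cell_def)
    also have "\<dots> = (\<Sum>i. emeasure N (D i \<inter> B))" by (simp add: piece)
    also have "\<dots> = emeasure N (\<Union>i. D i \<inter> B)"
      by (rule suminf_emeasure) (auto simp: disjoint_family_on_def D_def cell_def)
    also have "(\<Union>i. D i \<inter> B) = B"
      using sets.sets_into_space[OF B] measurable_space[OF g] by (auto simp: D_def cell_def)
    finally show "emeasure (distr M N G) B = emeasure N B" .
  qed simp
  moreover have "AE x in M. dist (g (G x)) x < \<epsilon>"
  proof -
    have "AE x in M. x \<in> cell i \<longrightarrow> g (S i x) \<in> cell i" for i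
    proof (cases "emeasure M (cell i) = 0")
      case True
      then have "AE x in M. x \<notin> cell i" by (intro AE_not_in) (auto simp: null_sets_def)
      then show ?thesis by eventually_elim simp
    next
      case False
      have "AE z in uniform_measure N (D i). g z \<in> cell i"
        by (intro AE_uniform_measureI) (auto simp: D_def)
      then have "AE z in distr (uniform_measure M (cell i)) N (S i). g z \<in> cell i"
        by (subst SN[OF False])
      then have "AE x in uniform_measure M (cell i). g (S i x) \<in> cell i"
        by (subst (asm) AE_distr_iff) (auto cong: measurable_cong_sets)
      then show ?thesis using False
        by (subst (asm) AE_uniform_measure) (auto simp: M.emeasure_eq_measure)
    qed
    then have "AE x in M. \<forall>i. x \<in> cell i \<longrightarrow> g (S i x) \<in> cell i"
      by (simp add: AE_all_countable)
    with AE_space show ?thesis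
    proof eventually_elim
      case (elim x)
      then have "g (G x) \<in> cell (idx x)" by (auto simp: G_def cell_def)
      then have "g (G x) \<in> X" "idx (g (G x)) = idx x" by (auto simp: cell_def spM)
      then have "dist (c (idx x)) (g (G x)) < \<epsilon>/2" using idx by metis
      moreover have "dist (c (idx x)) x < \<epsilon>/2" using idx elim spM by simp
      ultimately show ?case by (metis dist_commute dist_triangle_half_l)
    qed
  qed
  ultimately show ?thesis using G by blast
qed

lemma sets_pair_borel_on:
  fixes X :: "'a::second_countable_topology set" and Y :: "'b::second_countable_topology set"
  shows "sets (borel_on X \<Otimes>\<^sub>M borel_on Y) = sets (borel_on (X \<times> Y))"
proof
  show "sets (borel_on X \<Otimes>\<^sub>M borel_on Y) \<subseteq> sets (borel_on (X \<times> Y))"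
  proof (rule sets_pair_in_sets)
    fix a b assume "a \<in> sets (borel_on X)" "b \<in> sets (borel_on Y)"
    then obtain a' b' where "a' \<in> sets borel" "b' \<in> sets borel" "a = X \<inter> a'" "b = Y \<inter> b'"
      by (auto simp: sets_restrict_space)
    moreover from this have "a' \<times> b' \<in> sets borel"
      unfolding borel_prod[symmetric] by simp
    moreover have "a \<times> b = (X \<times> Y) \<inter> (a' \<times> b')" using calculation by auto
    ultimately show "a \<times> b \<in> sets (borel_on (X \<times> Y))"
      by (auto simp: sets_restrict_space)
  qed
  have "(\<lambda>z. z) \<in> borel_on X \<Otimes>\<^sub>M borel_on Y \<rightarrow>\<^sub>M borel"
    unfolding borel_prod[symmetric]
    by (rule measurable_pair)
       (auto simp: comp_def intro!: measurable_compose[OF measurable_fst] measurable_compose[OF measurable_snd]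
          measurable_restrict_space1)
  then have "(\<lambda>z. z) \<in> borel_on X \<Otimes>\<^sub>M borel_on Y \<rightarrow>\<^sub>M borel_on (X \<times> Y)"
    by (intro measurable_restrict_space2) (auto simp: space_pair_measure space_restrict_space)
  from measurable_sets[OF this]
  show "sets (borel_on (X \<times> Y)) \<subseteq> sets (borel_on X \<Otimes>\<^sub>M borel_on Y)"
    using sets.sets_into_space[of _ "borel_on (X \<times> Y)"]
    by (auto simp: space_pair_measure space_restrict_space Int_absorb2)
qed

lemma integrable_continuous_compact:
  fixes f :: "'a::topological_space \<Rightarrow> real"
  assumes "prob_space M" "sets M = sets (borel_on K)" "compact K" "continuous_on K f"
  shows "integrable M f"
proof -
  interpret prob_space M by fact
  have "space M = K" using sets_eq_imp_space_eq[OF assms(2)] by (simp add: space_restrict_space)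
  moreover obtain B where "\<And>x. x \<in> K \<Longrightarrow> norm (f x) \<le> B"
    using compact_imp_bounded[OF compact_continuous_image[OF assms(4,3)]]
    unfolding bounded_iff by auto
  moreover have "f \<in> borel_measurable M"
    unfolding measurable_cong_sets[OF assms(2) refl]
    by (rule borel_measurable_continuous_on_restrict) fact
  ultimately show ?thesis by (intro integrable_const_bound[of _ B]) auto
qed

text \<open>
  If \<open>G\<close> pushes \<open>\<mu>\<close> to the coupling and the first component of \<open>G x\<close> is close to \<open>x\<close>, then the
  second component of \<open>G\<close> is a transport map with exactly the right marginals. Only its cost is approximate,
  since the first argument of the uniformly continuous cost has moved a little.
\<close>

lemma transport_map_near_coupling:
  fixes X :: "'a::euclidean_space set" and Y :: "'b::euclidean_space set"
    and c :: "'a \<Rightarrow> 'b \<Rightarrow> real"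
  assumes X: "compact X" and Y: "compact Y"
    and c: "continuous_on (X \<times> Y) (\<lambda>(x, y). c x y)"
    and \<mu>: "\<mu> \<in> borel_prob_measures X" and \<nu>: "\<nu> \<in> borel_prob_measures Y"
    and f: "f \<in> borel_measurable \<mu>" and atomless: "\<And>r::real. AE x in \<mu>. f x \<noteq> r"
    and \<pi>: "\<pi> \<in> couplings \<mu> \<nu>" and \<epsilon>: "\<epsilon> > 0"
  shows "\<exists>S\<in>transport_maps X Y \<mu> \<nu>. transport_cost c \<mu> S \<le> (\<integral>z. c (fst z) (snd z) \<partial>\<pi>) + \<epsilon>"
proof -
  have sets\<mu>: "sets \<mu> = sets (borel_on X)" and P: "prob_space \<mu>"
    and sets\<nu>: "sets \<nu> = sets (borel_on Y)" and Q: "prob_space \<nu>"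
    using \<mu> \<nu> by (auto simp: borel_prob_measures_def)
  interpret \<mu>: prob_space \<mu> by (rule P)
  have \<pi>': "prob_space \<pi>" "sets \<pi> = sets (\<mu> \<Otimes>\<^sub>M \<nu>)" "distr \<pi> \<mu> fst = \<mu>" "distr \<pi> \<nu> snd = \<nu>"
    using \<pi> by (auto simp: couplings_def)
  have "sets (\<mu> \<Otimes>\<^sub>M \<nu>) = sets (borel_on X \<Otimes>\<^sub>M borel_on Y)"
    by (rule sets_pair_measure_cong[OF sets\<mu> sets\<nu>])
  then have sets\<pi>: "sets \<pi> = sets (borel_on (X \<times> Y))"
    by (simp add: \<pi>'(2) sets_pair_borel_on)
  have spaces: "space \<mu> = X" "space \<nu> = Y" "space \<pi> = X \<times> Y"
    using sets_eq_imp_space_eq[OF sets\<mu>] sets_eq_imp_space_eq[OF sets\<nu>]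
      sets_eq_imp_space_eq[OF sets\<pi>] by (auto simp: space_restrict_space)
  have fst [measurable]: "fst \<in> \<pi> \<rightarrow>\<^sub>M \<mu>" and snd [measurable]: "snd \<in> \<pi> \<rightarrow>\<^sub>M \<nu>"
    unfolding measurable_cong_sets[OF \<pi>'(2) refl] by simp_all
  have XY: "compact (X \<times> Y)" by (intro compact_Times X Y)
  have intc: "integrable \<pi> (\<lambda>(x, y). c x y)"
    by (rule integrable_continuous_compact[OF \<pi>'(1) sets\<pi> XY c])
  then have cm [measurable]: "(\<lambda>(x, y). c x y) \<in> borel_measurable \<pi>" by auto
  obtain \<delta> where \<delta>: "\<delta> > 0" "\<And>z w. z \<in> X \<times> Y \<Longrightarrow> w \<in> X \<times> Y \<Longrightarrow> dist w z < \<delta> \<Longrightarrow>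
      dist (case w of (x, y) \<Rightarrow> c x y) (case z of (x, y) \<Rightarrow> c x y) < \<epsilon>"
    using compact_uniformly_continuous[OF c XY] \<epsilon> unfolding uniformly_continuous_on_def by metis
  have XYb: "X \<times> Y \<in> sets borel" using XY by (intro borel_closed compact_imp_closed)
  obtain G where G [measurable]: "G \<in> \<mu> \<rightarrow>\<^sub>M \<pi>" and G\<pi>: "distr \<mu> \<pi> G = \<pi>"
    and near: "AE x in \<mu>. dist (fst (G x)) x < \<delta>"
    using transport_along_factor[OF P sets\<mu> X f atomless \<pi>'(1) sets\<pi> XYb fst \<pi>'(3) \<delta>(1)] by blast
  define S where "S x = snd (G x)" for x
  have S [measurable]: "S \<in> \<mu> \<rightarrow>\<^sub>M \<nu>" unfolding S_def by measurable
  have SX: "S x \<in> Y" if "x \<in> X" for x using measurable_space[OF S, of x] that by (simp add: spaces)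
  have "distr \<mu> \<nu> S = distr (distr \<mu> \<pi> G) \<nu> snd"
    by (simp add: distr_distr comp_def S_def[abs_def])
  then have "distr \<mu> \<nu> S = \<nu>" by (simp add: G\<pi> \<pi>'(4))
  then have "push_forward Y S \<mu> = \<nu>"
    unfolding push_forward_def using distr_cong[OF refl sets\<nu>] by metis
  then have tm: "S \<in> transport_maps X Y \<mu> \<nu>"
    using S measurable_cong_sets[OF sets\<mu> sets\<nu>] by (auto simp: transport_maps_def)
  have pairm: "(\<lambda>x. (x, S x)) \<in> \<mu> \<rightarrow>\<^sub>M \<pi>"
    unfolding measurable_cong_sets[OF refl \<pi>'(2)] by measurable
  obtain B where B: "\<And>z. z \<in> X \<times> Y \<Longrightarrow> norm (case z of (x, y) \<Rightarrow> c x y) \<le> B"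
    using compact_imp_bounded[OF compact_continuous_image[OF c XY]]
    unfolding bounded_iff by auto
  have int1: "integrable \<mu> (\<lambda>x. c x (S x))"
  proof (rule \<mu>.integrable_const_bound)
    show "AE x in \<mu>. norm (c x (S x)) \<le> B"
      using AE_space by eventually_elim (use B SX in \<open>auto simp: spaces\<close>)
    show "(\<lambda>x. c x (S x)) \<in> borel_measurable \<mu>"
      using measurable_compose[OF pairm cm] by simp
  qed
  have int2: "integrable \<mu> (\<lambda>x. case G x of (x, y) \<Rightarrow> c x y)"
    using intc by (subst (asm) G\<pi>[symmetric]) (simp add: integrable_distr_eq)
  have "transport_cost c \<mu> S \<le> (\<integral>x. (case G x of (x, y) \<Rightarrow> c x y) + \<epsilon> \<partial>\<mu>)"
    unfolding transport_cost_def
  proof (rule integral_mono_AE)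
    show "AE x in \<mu>. c x (S x) \<le> (case G x of (x, y) \<Rightarrow> c x y) + \<epsilon>"
      using near AE_space
    proof eventually_elim
      case (elim x)
      have GX: "G x \<in> X \<times> Y" using measurable_space[OF G, of x] elim by (simp add: spaces)
      have "dist (x, S x) (G x) < \<delta>"
        using elim by (cases "G x") (simp add: S_def dist_Pair_Pair dist_commute)
      then have "dist (case (x, S x) of (x, y) \<Rightarrow> c x y) (case G x of (x, y) \<Rightarrow> c x y) < \<epsilon>"
        using GX elim SX by (intro \<delta>(2)) (auto simp: spaces)
      then show ?case by (simp add: dist_real_def)
    qed
  qed (use int1 int2 in auto)
  also have "\<dots> = (\<integral>x. (case G x of (x, y) \<Rightarrow> c x y) \<partial>\<mu>) + \<epsilon>"
    using int2 by (simp add: \<mu>.prob_space)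
  also have "(\<integral>x. (case G x of (x, y) \<Rightarrow> c x y) \<partial>\<mu>) = (\<integral>z. (case z of (x, y) \<Rightarrow> c x y) \<partial>distr \<mu> \<pi> G)"
    by (rule integral_distr[symmetric]) auto
  also have "\<dots> = (\<integral>z. c (fst z) (snd z) \<partial>\<pi>)"
    unfolding G\<pi> by (simp add: case_prod_unfold)
  finally show ?thesis using tm by blast
qed

text \<open>
  An optimal map is compared with the transport maps near an arbitrary coupling, so it costs no more
  than that coupling; and the map itself induces the coupling \<open>\<gamma>\<close> of equal cost.
\<close>

lemma monge_eq_kantorovich:
  fixes X :: "'a::euclidean_space set" and Y :: "'b::euclidean_space set"
    and c :: "'a \<Rightarrow> 'b \<Rightarrow> real"
  assumes X: "compact X" and Y: "compact Y"
    and c: "continuous_on (X \<times> Y) (\<lambda>(x, y). c x y)"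
    and \<mu>: "\<mu> \<in> borel_prob_measures X" and \<nu>: "\<nu> \<in> borel_prob_measures Y"
    and f: "f \<in> borel_measurable \<mu>" and atomless: "\<And>r::real. AE x in \<mu>. f x \<noteq> r"
    and T: "optimal_transport_map X Y c \<mu> \<nu> T"
  shows "(INF \<pi>\<in>couplings \<mu> \<nu>. \<integral>z. c (fst z) (snd z) \<partial>\<pi>) = transport_cost c \<mu> T"
proof -
  have sets\<mu>: "sets \<mu> = sets (borel_on X)" and P: "prob_space \<mu>"
    and sets\<nu>: "sets \<nu> = sets (borel_on Y)" and Q: "prob_space \<nu>"
    using \<mu> \<nu> by (auto simp: borel_prob_measures_def)
  interpret \<mu>: prob_space \<mu> by (rule P)
  have T': "T \<in> transport_maps X Y \<mu> \<nu>"
    "\<And>S. S \<in> transport_maps X Y \<mu> \<nu> \<Longrightarrow> transport_cost c \<mu> T \<le> transport_cost c \<mu> S"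
    using T by (auto simp: optimal_transport_map_def)
  have Tm [measurable]: "T \<in> \<mu> \<rightarrow>\<^sub>M \<nu>"
    using T'(1) measurable_cong_sets[OF sets\<mu> sets\<nu>] by (auto simp: transport_maps_def)
  have T\<nu>: "distr \<mu> \<nu> T = \<nu>"
    using T'(1) distr_cong[OF refl sets\<nu>, of \<mu> T T] by (simp add: transport_maps_def push_forward_def)
  have le: "transport_cost c \<mu> T \<le> (\<integral>z. c (fst z) (snd z) \<partial>\<pi>)" if "\<pi> \<in> couplings \<mu> \<nu>" for \<pi>
  proof (rule field_le_epsilon)
    fix \<epsilon> :: real assume "\<epsilon> > 0"
    then show "transport_cost c \<mu> T \<le> (\<integral>z. c (fst z) (snd z) \<partial>\<pi>) + \<epsilon>"
      using transport_map_near_coupling[OF X Y c \<mu> \<nu> f atomless that] T'(2) order_trans by blast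
  qed
  define \<gamma> where "\<gamma> = distr \<mu> (\<mu> \<Otimes>\<^sub>M \<nu>) (\<lambda>x. (x, T x))"
  have "\<gamma> \<in> couplings \<mu> \<nu>"
    unfolding couplings_def \<gamma>_def
    by (auto intro!: \<mu>.prob_space_distr simp: distr_distr comp_def T\<nu> distr_id)
  moreover have "(\<integral>z. c (fst z) (snd z) \<partial>\<gamma>) = transport_cost c \<mu> T"
  proof -
    have "sets (\<mu> \<Otimes>\<^sub>M \<nu>) = sets (borel_on (X \<times> Y))"
      using sets_pair_measure_cong[OF sets\<mu> sets\<nu>] by (simp add: sets_pair_borel_on)
    then have "(\<lambda>(x, y). c x y) \<in> borel_measurable (\<mu> \<Otimes>\<^sub>M \<nu>)"
      using borel_measurable_continuous_on_restrict[OF c] by (simp cong: measurable_cong_sets)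
    then show ?thesis
      unfolding \<gamma>_def transport_cost_def
      by (subst integral_distr) (auto simp: case_prod_unfold)
  qed
  ultimately show ?thesis
    using le by (intro cInf_eq_minimum) (auto intro!: image_eqI[of _ _ \<gamma>])
qed

section \<open>Stability under convergence of the maps\<close>

text \<open>
  The variance of the distance between the two maps is nonnegative.
\<close>

lemma (in prob_space) integral_norm_le_L2_distance:
  fixes s T :: "'a \<Rightarrow> 'b::euclidean_space"
  assumes [measurable]: "s \<in> borel_measurable M" "T \<in> borel_measurable M"
    and int: "integrable M (\<lambda>x. (norm (s x - T x))\<^sup>2)"
  shows "(\<integral>x. norm (s x - T x) \<partial>M) \<le> L2_distance M s T"
proof -
  have "integrable M (\<lambda>x. norm (s x - T x))"
    by (rule square_integrable_imp_integrable[OF _ int]) simp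
  then have "(\<integral>x. norm (s x - T x) \<partial>M)\<^sup>2 \<le> (\<integral>x. (norm (s x - T x))\<^sup>2 \<partial>M)"
    using variance_positive[of "\<lambda>x. norm (s x - T x)"] int by (simp add: variance_eq)
  then show ?thesis unfolding L2_distance_def by (rule real_le_rsqrt)
qed

lemma integrable_norm_diff_power:
  fixes Y :: "'b::euclidean_space set"
  assumes M: "prob_space M" and Y: "compact Y"
    and s: "s \<in> M \<rightarrow>\<^sub>M borel_on Y" and T: "T \<in> M \<rightarrow>\<^sub>M borel_on Y"
  shows "integrable M (\<lambda>x. norm (s x - T x) ^ n)"
proof -
  interpret prob_space M by fact
  have sT: "s x \<in> Y" "T x \<in> Y" if "x \<in> space M" for x
    using measurable_space[OF s that] measurable_space[OF T that] by (auto simp: space_restrict_space)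
  have [measurable]: "s \<in> borel_measurable M" "T \<in> borel_measurable M"
    using s T by (auto simp: measurable_restrict_space2_iff)
  have "AE x in M. norm (norm (s x - T x) ^ n) \<le> diameter Y ^ n"
    using AE_space
  proof eventually_elim
    case (elim x)
    have "norm (s x - T x) \<le> diameter Y"
      using diameter_bounded_bound[OF compact_imp_bounded[OF Y] sT[OF elim]] by (simp add: dist_norm)
    then show ?case by (simp add: power_mono)
  qed
  then show ?thesis by (rule integrable_const_bound) simp
qed

lemma lipschitz_integral_push_forward_le:
  fixes Y :: "'b::euclidean_space set" and \<phi> :: "'b \<Rightarrow> real"
  assumes M: "prob_space M" and Y: "compact Y" and \<phi>: "C-lipschitz_on Y \<phi>"
    and s [measurable]: "s \<in> M \<rightarrow>\<^sub>M borel_on Y" and T [measurable]: "T \<in> M \<rightarrow>\<^sub>M borel_on Y"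
  shows "\<bar>(\<integral>y. \<phi> y \<partial>push_forward Y s M) - (\<integral>y. \<phi> y \<partial>push_forward Y T M)\<bar>
           \<le> C * (\<integral>x. norm (s x - T x) \<partial>M)"
proof -
  interpret prob_space M by fact
  have sT: "s x \<in> Y" "T x \<in> Y" if "x \<in> space M" for x
    using measurable_space[OF s that] measurable_space[OF T that] by (auto simp: space_restrict_space)
  have [measurable]: "s \<in> borel_measurable M" "T \<in> borel_measurable M"
    using s T by (auto simp: measurable_restrict_space2_iff)
  have cont: "continuous_on Y \<phi>" using \<phi> by (rule lipschitz_on_continuous_on)
  have \<phi>m [measurable]: "\<phi> \<in> borel_measurable (borel_on Y)"
    by (rule borel_measurable_continuous_on_restrict[OF cont])
  have int: "integrable M (\<lambda>x. \<phi> (u x))" if u: "u \<in> M \<rightarrow>\<^sub>M borel_on Y" for u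
  proof -
    have "integrable (distr M (borel_on Y) u) \<phi>"
      by (rule integrable_continuous_compact[OF prob_space_distr[OF u] _ Y cont]) simp
    then show ?thesis using u by (simp add: integrable_distr_eq)
  qed
  have intn: "integrable M (\<lambda>x. norm (s x - T x))"
    using integrable_norm_diff_power[OF M Y s T, of 1] by simp
  have "\<bar>(\<integral>y. \<phi> y \<partial>push_forward Y s M) - (\<integral>y. \<phi> y \<partial>push_forward Y T M)\<bar>
      = \<bar>\<integral>x. \<phi> (s x) - \<phi> (T x) \<partial>M\<bar>"
    using int[OF s] int[OF T] by (simp add: push_forward_def integral_distr)
  also have "\<dots> \<le> (\<integral>x. \<bar>\<phi> (s x) - \<phi> (T x)\<bar> \<partial>M)"
    by (rule integral_abs_bound)
  also have "\<dots> \<le> (\<integral>x. C * norm (s x - T x) \<partial>M)"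
    using int[OF s] int[OF T] intn lipschitz_onD[OF \<phi>] sT
    by (intro integral_mono) (auto simp: dist_norm)
  finally show ?thesis by simp
qed

lemma abs_d_KR_push_forward_le:
  fixes Y :: "'b::euclidean_space set"
  assumes "prob_space M" "compact Y" "s \<in> M \<rightarrow>\<^sub>M borel_on Y" "T \<in> M \<rightarrow>\<^sub>M borel_on Y"
  shows "\<bar>d_KR Y (push_forward Y s M) (push_forward Y T M)\<bar> \<le> (\<integral>x. norm (s x - T x) \<partial>M)"
proof -
  let ?\<Phi> = "{\<phi>. (\<forall>y\<in>Y. \<bar>\<phi> y\<bar> \<le> 1) \<and> (\<forall>x\<in>Y. \<forall>y\<in>Y. \<bar>\<phi> x - \<phi> y\<bar> \<le> dist x y)}"
  let ?I = "\<lambda>\<phi>. (\<integral>y. \<phi> y \<partial>push_forward Y s M) - (\<integral>y. \<phi> y \<partial>push_forward Y T M)"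
  have le: "?I \<phi> \<le> (\<integral>x. norm (s x - T x) \<partial>M)" if "\<phi> \<in> ?\<Phi>" for \<phi>
  proof -
    have "1-lipschitz_on Y \<phi>" using that by (auto simp: lipschitz_on_def dist_real_def)
    from lipschitz_integral_push_forward_le[OF assms(1,2) this assms(3,4)] show ?thesis by simp
  qed
  have zero: "(\<lambda>_. 0) \<in> ?\<Phi>" by simp
  have "bdd_above (?I ` ?\<Phi>)" using le by (intro bdd_aboveI2)
  then have "?I (\<lambda>_. 0) \<le> (SUP \<phi>\<in>?\<Phi>. ?I \<phi>)" by (rule cSUP_upper[OF zero])
  moreover have "(SUP \<phi>\<in>?\<Phi>. ?I \<phi>) \<le> (\<integral>x. norm (s x - T x) \<partial>M)"
  proof (rule cSUP_least)
    show "?\<Phi> \<noteq> {}" 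
      unfolding ex_in_conv[symmetric] by (intro exI[of _ "\<lambda>_. 0"]) simp
  qed (rule le)
  ultimately show ?thesis unfolding d_KR_def by simp
qed

text \<open>
  A difference of squares: one factor is controlled by the reverse triangle inequality, the other
  by the bound \<open>R\<close>.
\<close>

lemma quadratic_cost_lipschitz:
  fixes x y z :: "'a::real_normed_vector"
  assumes "norm (x - y) \<le> R" "norm (x - z) \<le> R"
  shows "\<bar>quadratic_cost x y - quadratic_cost x z\<bar> \<le> R * norm (y - z)"
proof -
  have "quadratic_cost x y - quadratic_cost x z
      = 1/2 * (norm (x - y) + norm (x - z)) * (norm (x - y) - norm (x - z))"
    by (simp add: quadratic_cost_def power2_eq_square algebra_simps)
  moreover have "\<bar>norm (x - y) - norm (x - z)\<bar> \<le> norm (y - z)"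
    using norm_triangle_ineq3[of "x - y" "x - z"] by (simp add: norm_minus_commute)
  moreover have "\<bar>1/2 * (norm (x - y) + norm (x - z))\<bar> \<le> R" using assms by simp
  moreover have "0 \<le> R" using assms(1) norm_ge_zero order_trans by blast
  ultimately show ?thesis by (simp only: abs_mult) (intro mult_mono; simp)
qed

lemma transport_cost_quadratic_diff_le:
  fixes X Y :: "'a::euclidean_space set"
  assumes M: "prob_space M" "sets M = sets (borel_on X)" and Y: "compact Y"
    and R: "\<And>x y. x \<in> X \<Longrightarrow> y \<in> Y \<Longrightarrow> norm (x - y) \<le> R"
    and s [measurable]: "s \<in> M \<rightarrow>\<^sub>M borel_on Y" and T [measurable]: "T \<in> M \<rightarrow>\<^sub>M borel_on Y"
  shows "\<bar>transport_cost quadratic_cost M s - transport_cost quadratic_cost M T\<bar>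
           \<le> R * (\<integral>x. norm (s x - T x) \<partial>M)"
proof -
  interpret prob_space M by fact
  have X: "space M = X" using sets_eq_imp_space_eq[OF M(2)] by (simp add: space_restrict_space)
  have in_Y: "u x \<in> Y" if "u \<in> M \<rightarrow>\<^sub>M borel_on Y" "x \<in> X" for u :: "'a \<Rightarrow> 'a" and x
    using measurable_space[OF that(1), of x] that(2) by (auto simp: X space_restrict_space)
  have m: "u \<in> borel_measurable M" if "u \<in> M \<rightarrow>\<^sub>M borel_on Y" for u :: "'a \<Rightarrow> 'a"
    using that by (auto simp: measurable_restrict_space2_iff)
  have idm [measurable]: "(\<lambda>x. x) \<in> M \<rightarrow>\<^sub>M borel"
    unfolding measurable_cong_sets[OF M(2) refl] by (intro measurable_restrict_space1) simp
  have int: "integrable M (\<lambda>x. quadratic_cost x (u x))" if u: "u \<in> M \<rightarrow>\<^sub>M borel_on Y" for u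
  proof (rule integrable_const_bound)
    show "AE x in M. norm (quadratic_cost x (u x)) \<le> 1/2 * R\<^sup>2"
      using AE_space
      by eventually_elim (auto simp: quadratic_cost_def X intro!: power_mono R in_Y[OF u])
    show "(\<lambda>x. quadratic_cost x (u x)) \<in> borel_measurable M"
      unfolding quadratic_cost_def using m[OF u] by measurable
  qed
  have intn: "integrable M (\<lambda>x. norm (s x - T x))"
    using integrable_norm_diff_power[OF M(1) Y s T, of 1] by simp
  have "\<bar>transport_cost quadratic_cost M s - transport_cost quadratic_cost M T\<bar>
      = \<bar>\<integral>x. quadratic_cost x (s x) - quadratic_cost x (T x) \<partial>M\<bar>"
    using int[OF s] int[OF T] by (simp add: transport_cost_def)
  also have "\<dots> \<le> (\<integral>x. \<bar>quadratic_cost x (s x) - quadratic_cost x (T x)\<bar> \<partial>M)"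
    by (rule integral_abs_bound)
  also have "\<dots> \<le> (\<integral>x. R * norm (s x - T x) \<partial>M)"
    using int[OF s] int[OF T] intn
    by (intro integral_mono) (auto simp: X intro!: quadratic_cost_lipschitz R in_Y[OF s] in_Y[OF T])
  finally show ?thesis by simp
qed

lemma hoelder_on_imp_continuous_on:
  assumes "hoelder_on \<alpha> S f" "\<alpha> > 0"
  shows "continuous_on S f"
proof -
  obtain C where C: "\<And>x y. x \<in> S \<Longrightarrow> y \<in> S \<Longrightarrow> dist (f x) (f y) \<le> C * dist x y powr \<alpha>"
    using assms(1) unfolding hoelder_on_def by blast
  show ?thesis
    unfolding continuous_on_def
  proof
    fix x assume x: "x \<in> S"
    have "((\<lambda>y. C * dist x y powr \<alpha>) \<longlongrightarrow> C * 0 powr \<alpha>) (at x within S)"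
      using assms(2) by (intro tendsto_intros tendsto_powr2 tendsto_eq_intros refl) auto
    then have "((\<lambda>y. C * dist x y powr \<alpha>) \<longlongrightarrow> 0) (at x within S)" by simp
    moreover have "\<forall>\<^sub>F y in at x within S. dist (f y) (f x) \<le> dist (C * dist x y powr \<alpha>) 0"
      unfolding eventually_at_filter using C[OF x]
      by (intro always_eventually) (force simp: dist_commute)
    ultimately show "(f \<longlongrightarrow> f x) (at x within S)" by (rule metric_tendsto_imp_tendsto)
  qed
qed

text \<open>
  Hyperplanes are Lebesgue null sets. Continuity serves to make \<open>p\<close> measurable,
  so that null sets carry over to the measure with density \<open>p\<close>.
\<close>

lemma AE_density_inner_neq:
  fixes X :: "'a::euclidean_space set"
  assumes dens: "has_density_on M X p" and X: "X \<in> sets borel" and b: "b \<noteq> 0"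
    and p: "continuous_on X p"
  shows "AE x in M. b \<bullet> x \<noteq> r"
proof -
  have "negligible {x. b \<bullet> x = r}" using b by (intro negligible_hyperplane) auto
  then have "AE x in lebesgue. b \<bullet> x \<noteq> r"
    by (intro AE_I'[of "{x. b \<bullet> x = r}"]) (auto simp: negligible_iff_null_sets)
  then have "AE x in lborel. b \<bullet> x \<noteq> r" by (simp add: AE_completion_iff)
  then have ae: "AE x in restrict_space lborel X. b \<bullet> x \<noteq> r"
    using X by (subst AE_restrict_space_iff) (auto elim: eventually_mono)
  have "sets (restrict_space lborel X) = sets (borel_on X)"
    by (intro sets_restrict_space_cong) simp
  then have "p \<in> borel_measurable (restrict_space lborel X)"
    using borel_measurable_continuous_on_restrict[OF p] measurable_cong_sets by blast
  then have "(\<lambda>x. ennreal (p x)) \<in> borel_measurable (restrict_space lborel X)" by measurable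
  moreover from ae have "AE x in restrict_space lborel X. 0 < ennreal (p x) \<longrightarrow> b \<bullet> x \<noteq> r"
    by eventually_elim simp
  ultimately show ?thesis
    unfolding dens[unfolded has_density_on_def] by (simp only: AE_density)
qed

section \<open>Convergence of the saddle functional and of the push-forwards\<close>

theorem mainTheorem3:
  fixes X Y :: "(real^'n) set"
    and \<alpha> L :: real
    and \<mu> \<nu> :: "(real^'n) measure"
    and p q :: "real^'n \<Rightarrow> real"
    and T :: "real^'n \<Rightarrow> real^'n"
    and t :: "nat \<Rightarrow> real^'n \<Rightarrow> real^'n"
    and \<psi> :: "nat \<Rightarrow> real^'n \<Rightarrow> real"
  assumes "0 < \<alpha>" "\<alpha> < 1"
    and "compact X" "uniformly_convex X" "C2_hoelder_boundary \<alpha> X"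
    and "compact Y" "uniformly_convex Y" "C2_hoelder_boundary \<alpha> Y"
    and "\<mu> \<in> borel_prob_measures X" "has_density_on \<mu> X p"
    and "hoelder_on \<alpha> X p" "\<exists>m>0. \<forall>x\<in>X. m \<le> p x"
    and "\<nu> \<in> borel_prob_measures Y" "has_density_on \<nu> Y q"
    and "hoelder_on \<alpha> Y q" "\<exists>m>0. \<forall>y\<in>Y. m \<le> q y"
    and "optimal_transport_map X Y quadratic_cost \<mu> \<nu> T"
    and "\<And>k. t k \<in> borel_on X \<rightarrow>\<^sub>M borel_on Y"
    and "\<And>k. t k \<in> L2_maps \<mu>"
    and "\<And>k. continuous_on Y (\<psi> k)"
    and "\<And>k. L-lipschitz_on Y (\<psi> k)"
    and "(\<lambda>k. L2_distance \<mu> (t k) T) \<longlonglongrightarrow> 0"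
  shows "(\<lambda>k. saddle_functional Y quadratic_cost \<mu> \<nu> (\<psi> k) (t k)) \<longlonglongrightarrow> (W2 \<mu> \<nu>)\<^sup>2 \<and>
         (\<lambda>k. d_KR Y (push_forward Y (t k) \<mu>) \<nu>) \<longlonglongrightarrow> 0"
proof -
  note X = \<open>compact X\<close> and Y = \<open>compact Y\<close>
  note \<mu> = \<open>\<mu> \<in> borel_prob_measures X\<close> and \<nu> = \<open>\<nu> \<in> borel_prob_measures Y\<close>
  have P: "prob_space \<mu>" and sets\<mu>: "sets \<mu> = sets (borel_on X)"
    using \<mu> by (auto simp: borel_prob_measures_def)
  interpret \<mu>: prob_space \<mu> by (rule P)
  have t [measurable]: "t k \<in> \<mu> \<rightarrow>\<^sub>M borel_on Y" for k
    unfolding measurable_cong_sets[OF sets\<mu> refl] by fact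
  have T [measurable]: "T \<in> \<mu> \<rightarrow>\<^sub>M borel_on Y" and \<nu>T: "push_forward Y T \<mu> = \<nu>"
    using \<open>optimal_transport_map X Y quadratic_cost \<mu> \<nu> T\<close>
    unfolding measurable_cong_sets[OF sets\<mu> refl]
    by (auto simp: optimal_transport_map_def transport_maps_def)

  \<comment> \<open>Any nonzero direction gives a real-valued function whose law under the source measure has no atoms.\<close>
  define b where "b = (axis undefined 1 :: real^'n)"
  have "b \<noteq> 0" by (simp add: b_def axis_eq_0_iff)
  then have atomless: "AE x in \<mu>. b \<bullet> x \<noteq> r" for r
    using AE_density_inner_neq[OF \<open>has_density_on \<mu> X p\<close> borel_compact[OF X]]
      hoelder_on_imp_continuous_on[OF \<open>hoelder_on \<alpha> X p\<close> \<open>0 < \<alpha>\<close>] by blast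
  have bm: "(\<lambda>x. b \<bullet> x) \<in> borel_measurable \<mu>"
    unfolding measurable_cong_sets[OF sets\<mu> refl] by (intro measurable_restrict_space1) simp
  have "continuous_on (X \<times> Y) (\<lambda>(x, y). quadratic_cost x y)"
    unfolding quadratic_cost_def case_prod_unfold by (intro continuous_intros)
  note monge = monge_eq_kantorovich[OF X Y this \<mu> \<nu> bm atomless
      \<open>optimal_transport_map X Y quadratic_cost \<mu> \<nu> T\<close>]
  have "0 \<le> transport_cost quadratic_cost \<mu> T"
    unfolding transport_cost_def quadratic_cost_def by (intro Bochner_Integration.integral_nonneg) simp
  then have W2: "(W2 \<mu> \<nu>)\<^sup>2 = transport_cost quadratic_cost \<mu> T"
    unfolding W2_def monge by simp

  define \<delta> where "\<delta> k = (\<integral>x. norm (t k x - T x) \<partial>\<mu>)" for k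
  have "\<delta> \<longlonglongrightarrow> 0"
  proof (rule tendsto_sandwich[OF _ _ tendsto_const \<open>(\<lambda>k. L2_distance \<mu> (t k) T) \<longlonglongrightarrow> 0\<close>])
    have "t k \<in> borel_measurable \<mu>" "T \<in> borel_measurable \<mu>" for k
      using t[of k] T by (auto simp: measurable_restrict_space2_iff)
    then show "\<forall>\<^sub>F k in sequentially. \<delta> k \<le> L2_distance \<mu> (t k) T"
      unfolding \<delta>_def
      by (intro always_eventually allI \<mu>.integral_norm_le_L2_distance
          integrable_norm_diff_power[OF P Y t T])
  qed (simp add: \<delta>_def)

  obtain R where R: "\<And>x y. x \<in> X \<Longrightarrow> y \<in> Y \<Longrightarrow> norm (x - y) \<le> R"
  proof -
    obtain A where A: "\<forall>x\<in>X. norm x \<le> A"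
      using compact_imp_bounded[OF X] unfolding bounded_iff by (rule exE)
    obtain B where B: "\<forall>y\<in>Y. norm y \<le> B"
      using compact_imp_bounded[OF Y] unfolding bounded_iff by (rule exE)
    have "norm (x - y) \<le> A + B" if "x \<in> X" "y \<in> Y" for x y
      using norm_triangle_ineq4[of x y] bspec[OF A that(1)] bspec[OF B that(2)] by linarith
    then show ?thesis by (rule that)
  qed
  have "norm (saddle_functional Y quadratic_cost \<mu> \<nu> (\<psi> k) (t k) - (W2 \<mu> \<nu>)\<^sup>2) \<le> (R + L) * \<delta> k" for k
  proof -
    have "\<bar>transport_cost quadratic_cost \<mu> (t k) - transport_cost quadratic_cost \<mu> T\<bar> \<le> R * \<delta> k"
      unfolding \<delta>_def by (rule transport_cost_quadratic_diff_le[OF P sets\<mu> Y R t T])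
    moreover have "\<bar>(\<integral>y. \<psi> k y \<partial>push_forward Y (t k) \<mu>) - (\<integral>y. \<psi> k y \<partial>\<nu>)\<bar> \<le> L * \<delta> k"
      unfolding \<delta>_def
      by (rule lipschitz_integral_push_forward_le[OF P Y \<open>L-lipschitz_on Y (\<psi> k)\<close> t T, unfolded \<nu>T])
    ultimately show ?thesis
      unfolding saddle_functional_def W2 real_norm_def distrib_right by linarith
  qed
  moreover have "(\<lambda>k. (R + L) * \<delta> k) \<longlonglongrightarrow> 0"
    by (rule tendsto_mult_right_zero) fact
  ultimately have "(\<lambda>k. saddle_functional Y quadratic_cost \<mu> \<nu> (\<psi> k) (t k) - (W2 \<mu> \<nu>)\<^sup>2) \<longlonglongrightarrow> 0"
    by (rule Lim_null_comparison[OF always_eventually[OF allI]])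
  then have "(\<lambda>k. saddle_functional Y quadratic_cost \<mu> \<nu> (\<psi> k) (t k)) \<longlonglongrightarrow> (W2 \<mu> \<nu>)\<^sup>2"
    by (rule LIM_zero_cancel)
  moreover have "(\<lambda>k. d_KR Y (push_forward Y (t k) \<mu>) \<nu>) \<longlonglongrightarrow> 0"
  proof (rule Lim_null_comparison[OF always_eventually[OF allI] \<open>\<delta> \<longlonglongrightarrow> 0\<close>])
    show "norm (d_KR Y (push_forward Y (t k) \<mu>) \<nu>) \<le> \<delta> k" for k
      using abs_d_KR_push_forward_le[OF P Y t T, of k] by (simp add: \<nu>T \<delta>_def)
  qed
  ultimately show ?thesis by (rule conjI)
qed

end
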